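(* Let $p>2$ and $q>1$, and let $b_{p,q}:J_p\to J_q$ be the base-change function. (i) The function $b_{p,q}$ is Hölder continuous with the exact exponent $\frac{\log q}{\log p}$. (ii) If $q<2$, then $b_{p,q}$ is nowhere monotone. (iii) If $q=2$, then $b_{p,q}$ is non-decreasing. (iv) If $q>2$, then $b_{p,q}$ is (strictly) increasing.
   Context: For a real base $r>1$ and $c=(c_i)_{i\ge1}\in\{0,1\}^\infty$ put $\pi_r(c):=\sum_{i=1}^\infty c_i r^{-i}$ and $J_r:=\pi_r(\{0,1\}^\infty)$. For $p>2$ each $x\in J_p$ has a unique sequence $b_p(x)=(b_i)\in\{0,1\}^\infty$ with $\pi_p(b_p(x))=x$. The base-change function is $b_{p,q}:=\pi_q\circ b_p:J_p\to J_q$, i.e. $b_{p,q}(x)=\sum_{i\ge1}b_iq^{-i}$. A function $f$ on a set $D\subseteq\mathbb R$ is Hölder continuous with exponent $\alpha>0$ if there is a constant $C$ with $|f(x)-f(y)|\le C|x-y|^\alpha$ for all $x,y\in D$; the exponent is exact if it cannot be replaced by any larger one (it may exceed $1$ since $J_p$ is not an interval). "Nowhere monotone" means that $b_{p,q}$ is not monotone on $I\cap J_p$ for any open interval $I$ with $I\cap J_p\neq\varnothing$. "Increasing" means strictly increasing. *)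

theory Defs
  imports "HOL-Analysis.Analysis"
begin

text \<open>Sequences are indexed from 0 here: \<open>c i\<close> is the mathematical digit with index \<open>i + 1\<close>, hence
  the exponent \<open>Suc i\<close> in the expansion.\<close>

definition binseqs :: "(nat \<Rightarrow> nat) set" where
  "binseqs = UNIV \<rightarrow> {0, 1}"

definition proj :: "real \<Rightarrow> (nat \<Rightarrow> nat) \<Rightarrow> real" where
  "proj r c = (\<Sum>i. real (c i) / r ^ Suc i)"

definition J :: "real \<Rightarrow> real set" where
  "J r = proj r ` binseqs"

definition expansion :: "real \<Rightarrow> real \<Rightarrow> (nat \<Rightarrow> nat)" where
  "expansion p x = (THE b. b \<in> binseqs \<and> proj p b = x)"

definition base_change :: "real \<Rightarrow> real \<Rightarrow> real \<Rightarrow> real" where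
  "base_change p q x = proj q (expansion p x)"

definition holder_on :: "real \<Rightarrow> real set \<Rightarrow> (real \<Rightarrow> real) \<Rightarrow> bool" where
  "holder_on \<alpha> D f \<longleftrightarrow>
     \<alpha> > 0 \<and> (\<exists>C. \<forall>x\<in>D. \<forall>y\<in>D. \<bar>f x - f y\<bar> \<le> C * \<bar>x - y\<bar> powr \<alpha>)"

definition exact_holder_on :: "real \<Rightarrow> real set \<Rightarrow> (real \<Rightarrow> real) \<Rightarrow> bool" where
  "exact_holder_on \<alpha> D f \<longleftrightarrow> holder_on \<alpha> D f \<and> (\<forall>\<beta>>\<alpha>. \<not> holder_on \<beta> D f)"

text \<open>The open intervals of the real line, bounded or not, are exactly the sets that are both
  \<open>open\<close> and \<open>is_interval\<close>.\<close>

definition nowhere_monotone_on :: "real set \<Rightarrow> (real \<Rightarrow> real) \<Rightarrow> bool" where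
  "nowhere_monotone_on D f \<longleftrightarrow>
     (\<forall>I. open I \<and> is_interval I \<and> I \<inter> D \<noteq> {} \<longrightarrow>
        \<not> (mono_on (I \<inter> D) f \<or> antimono_on (I \<inter> D) f))"

text \<open>For \<open>p > 2\<close> the definite description in \<open>expansion\<close> is well defined on \<open>J p\<close>.\<close>

lemma summable_digits:
  assumes "r > 1" and "c \<in> binseqs"
  shows "summable (\<lambda>i. real (c i) / r ^ Suc i)"
proof (rule summable_comparison_test')
  have "summable (\<lambda>i. (1 / r) ^ i)"
    using assms by (intro summable_geometric) auto
  then show "summable (\<lambda>i. (1 / r) ^ Suc i)"
    by (simp only: summable_Suc_iff)
  fix i
  have "c i \<in> {0, 1}" using assms(2) by (auto simp: binseqs_def)
  then show "norm (real (c i) / r ^ Suc i) \<le> (1 / r) ^ Suc i"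
    using assms(1) by (auto simp: power_divide)
qed

lemma proj_inj_on:
  assumes "p > 2"
  shows "inj_on (proj p) binseqs"
proof (rule inj_onI, rule ccontr)
  fix b c assume b: "b \<in> binseqs" and c: "c \<in> binseqs" and eq: "proj p b = proj p c"
    and "b \<noteq> c"
  then have "\<exists>n. b n \<noteq> c n" by auto
  define n where "n = (LEAST n. b n \<noteq> c n)"
  have n: "b n \<noteq> c n" unfolding n_def by (rule LeastI_ex) fact
  have less: "b i = c i" if "i < n" for i
    using not_less_Least that unfolding n_def by blast
  define d where "d i = real (b i) / p ^ Suc i - real (c i) / p ^ Suc i" for i
  have bc: "b i \<in> {0, 1}" "c i \<in> {0, 1}" for i
    using b c by (auto simp: binseqs_def)
  have sb: "summable (\<lambda>i. real (b i) / p ^ Suc i)" "summable (\<lambda>i. real (c i) / p ^ Suc i)"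
    using assms b c by (auto intro!: summable_digits simp del: power_Suc)
  have sd: "summable d" unfolding d_def using sb by (rule summable_diff)
  have "suminf d = proj p b - proj p c"
    unfolding d_def proj_def using sb by (rule suminf_diff [symmetric])
  then have "0 = (\<Sum>i. d (i + Suc n)) + (\<Sum>i<Suc n. d i)"
    using eq suminf_split_initial_segment [OF sd, of "Suc n"] by simp
  also have "(\<Sum>i<Suc n. d i) = d n"
    using less by (simp add: d_def)
  finally have tail: "\<bar>d n\<bar> = \<bar>\<Sum>i. d (i + Suc n)\<bar>" by linarith
  have g: "(\<lambda>i. (1 / p) ^ i) sums (1 / (1 - 1 / p))"
    using assms by (intro geometric_sums) auto
  have g': "(\<lambda>i. (1 / p) ^ (n + 2) * (1 / p) ^ i) sums ((1 / p) ^ (n + 2) * (1 / (1 - 1 / p)))"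
    by (rule sums_mult [OF g])
  have bound: "norm (d (i + Suc n)) \<le> (1 / p) ^ (n + 2) * (1 / p) ^ i" for i
  proof -
    have "norm (d (i + Suc n)) \<le> 1 / p ^ Suc (i + Suc n)"
      using bc[of "i + Suc n"] assms by (auto simp: d_def)
    also have "\<dots> = (1 / p) ^ (n + 2) * (1 / p) ^ i"
      by (simp add: power_divide power_add)
    finally show ?thesis .
  qed
  have "norm (\<Sum>i. d (i + Suc n)) \<le> (\<Sum>i. (1 / p) ^ (n + 2) * (1 / p) ^ i)"
    by (rule norm_suminf_le [OF bound sums_summable [OF g']])
  also have "\<dots> = (1 / p) ^ (n + 2) * (1 / (1 - 1 / p))"
    using g' by (rule sums_unique [symmetric])
  also have "\<dots> = (1 / p) ^ Suc n * (1 / (p - 1))"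
    using assms by (simp add: field_simps)
  also have "\<dots> < (1 / p) ^ Suc n * 1"
    using assms by (intro mult_strict_left_mono) auto
  also have "\<dots> = \<bar>d n\<bar>"
    using bc[of n] n assms by (auto simp: d_def power_divide)
  finally show False using tail by simp
qed

lemma expansion_unique:
  assumes "p > 2" and "x \<in> J p"
  shows "\<exists>!b. b \<in> binseqs \<and> proj p b = x"
  using assms proj_inj_on [of p] by (auto simp: J_def inj_on_def)

lemma expansion_proj:
  assumes "p > 2" and "b \<in> binseqs"
  shows "expansion p (proj p b) = b"
  unfolding expansion_def using assms proj_inj_on [of p]
  by (intro the_equality) (auto simp: inj_on_def)

lemma base_change_maps:
  assumes "p > 2"
  shows "base_change p q \<in> J p \<rightarrow> J q"
  using assms by (auto simp: J_def base_change_def expansion_proj)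

end

theory Submission
  imports Defs
begin

text \<open>If two binary sequences first differ at index \<open>n\<close>, then their values in base \<open>r\<close> differ by
  \<open>1 + t - t'\<close> in units of \<open>r ^ - Suc n\<close>, where both tails \<open>t, t'\<close> lie in \<open>[0, 1 / (r - 1)]\<close>.
  For \<open>r > 2\<close> the difference therefore has exact order \<open>r ^ - n\<close> and the sign given by the
  lexicographic order. Comparing bases \<open>p\<close> and \<open>q\<close> at the same \<open>n\<close> gives the exponent, with
  exactness witnessed by \<open>0\<close> and \<open>p ^ - Suc n\<close>. For \<open>q < 2\<close> the value of \<open>w0111\<dots>\<close> exceeds that of
  \<open>w1000\<dots>\<close>, so every cylinder contains both an increase and a decrease.\<close>

section \<open>Range of the values and splitting off a prefix\<close>

lemma binseqs_shift: "c \<in> binseqs \<Longrightarrow> (\<lambda>i. c (i + n)) \<in> binseqs"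
  by (auto simp: binseqs_def Pi_def)

lemma binseqs_cases: "c \<in> binseqs \<Longrightarrow> c i = 0 \<or> c i = 1"
  by (auto simp: binseqs_def Pi_def)

lemma proj_zero: "proj r (\<lambda>_. 0) = 0"
  by (simp add: proj_def)

lemma proj_one:
  assumes "r > 1"
  shows "proj r (\<lambda>_. 1) = 1 / (r - 1)"
proof -
  have "(\<lambda>i. (1 / r) ^ i) sums (1 / (1 - 1 / r))"
    using assms by (intro geometric_sums) auto
  then have "(\<lambda>i. 1 / r * (1 / r) ^ i) sums (1 / r * (1 / (1 - 1 / r)))"
    by (rule sums_mult)
  moreover have "1 / r * (1 / (1 - 1 / r)) = 1 / (r - 1)"
    using assms by (simp add: field_simps)
  ultimately show ?thesis
    unfolding proj_def by (auto simp: power_divide sums_iff)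
qed

lemma proj_nonneg:
  assumes "r > 1" and "c \<in> binseqs"
  shows "0 \<le> proj r c"
  unfolding proj_def using assms by (intro suminf_nonneg summable_digits) auto

lemma proj_le:
  assumes "r > 1" and "c \<in> binseqs"
  shows "proj r c \<le> 1 / (r - 1)"
proof -
  have one: "(\<lambda>_. 1) \<in> binseqs" by (auto simp: binseqs_def)
  have "real (c i) / r ^ Suc i \<le> real 1 / r ^ Suc i" for i
    using assms(1) binseqs_cases[OF assms(2), of i] by (intro divide_right_mono) auto
  then have "proj r c \<le> proj r (\<lambda>_. 1)"
    unfolding proj_def using summable_digits[OF assms] summable_digits[OF assms(1) one]
    by (rule suminf_le)
  then show ?thesis using proj_one[OF assms(1)] by simp
qed

lemma proj_split:
  assumes "r > 1" and "c \<in> binseqs"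
  shows "proj r c = (\<Sum>i<n. real (c i) / r ^ Suc i) + proj r (\<lambda>i. c (i + n)) / r ^ n"
proof -
  have "(\<Sum>i. real (c (i + n)) / r ^ Suc (i + n)) = (\<Sum>i. real (c (i + n)) / r ^ Suc i / r ^ n)"
    by (simp add: power_add mult.assoc)
  also have "\<dots> = proj r (\<lambda>i. c (i + n)) / r ^ n"
    unfolding proj_def
    using summable_digits[OF assms(1) binseqs_shift[OF assms(2)]] by (rule suminf_divide)
  finally show ?thesis
    using suminf_split_initial_segment[OF summable_digits[OF assms], of n]
    unfolding proj_def by linarith
qed

section \<open>Differences of values of sequences with a common prefix\<close>

lemma proj_diff_agree:
  assumes "r > 1" and "b \<in> binseqs" and "c \<in> binseqs" and "\<And>i. i < n \<Longrightarrow> b i = c i"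
  shows "proj r b - proj r c = (proj r (\<lambda>i. b (i + n)) - proj r (\<lambda>i. c (i + n))) / r ^ n"
proof -
  have "(\<Sum>i<n. real (b i) / r ^ Suc i) = (\<Sum>i<n. real (c i) / r ^ Suc i)"
    using assms(4) by simp
  then show ?thesis
    using proj_split[OF assms(1,2), of n] proj_split[OF assms(1,3), of n]
    by (simp add: diff_divide_distrib)
qed

lemma proj_diff_first:
  assumes "r > 1" and "b \<in> binseqs" and "c \<in> binseqs" and "\<And>i. i < n \<Longrightarrow> b i = c i"
    and "b n = 1" and "c n = 0"
  shows "proj r b - proj r c =
    (1 + proj r (\<lambda>i. b (i + Suc n)) - proj r (\<lambda>i. c (i + Suc n))) / r ^ Suc n"
proof -
  have "(\<Sum>i<n. real (b i) / r ^ Suc i) = (\<Sum>i<n. real (c i) / r ^ Suc i)"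
    using assms(4) by simp
  then show ?thesis
    using proj_split[OF assms(1,2), of "Suc n"] proj_split[OF assms(1,3), of "Suc n"] assms(5,6)
    by (simp add: diff_divide_distrib add_divide_distrib)
qed

text \<open>After the common prefix both tails have values in \<open>[0, 1 / (r - 1)]\<close>, so
  they are at most the length of that interval apart. This works for every \<open>r > 1\<close> and
  so serves for both bases.\<close>

lemma proj_agree_close:
  assumes "r > 1" and "b \<in> binseqs" and "c \<in> binseqs" and "\<And>i. i < n \<Longrightarrow> b i = c i"
  shows "\<bar>proj r b - proj r c\<bar> \<le> (1 / (r - 1)) / r ^ n"
proof -
  let ?b = "\<lambda>i. b (i + n)" and ?c = "\<lambda>i. c (i + n)"
  have "\<bar>proj r ?b - proj r ?c\<bar> \<le> 1 / (r - 1)"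
    using proj_nonneg[OF assms(1) binseqs_shift[OF assms(2)], of n]
      proj_nonneg[OF assms(1) binseqs_shift[OF assms(3)], of n]
      proj_le[OF assms(1) binseqs_shift[OF assms(2)], of n]
      proj_le[OF assms(1) binseqs_shift[OF assms(3)], of n] by linarith
  moreover have "proj r b - proj r c = (proj r ?b - proj r ?c) / r ^ n"
    using assms by (rule proj_diff_agree)
  ultimately show ?thesis
    using assms(1) by (simp only: abs_divide) (simp add: divide_right_mono del: divide_divide_eq_left)
qed

text \<open>The extreme case is a tail of zeros after the 1 of \<open>b\<close> and a tail of ones
  after the 0 of \<open>c\<close>. The factor \<open>1 - 1 / (r - 1)\<close> is positive for
  \<open>r > 2\<close>, zero for \<open>r = 2\<close> and negative for \<open>r < 2\<close>; the
  three monotonicity regimes come from this sign.\<close>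

lemma proj_diff_first_lower:
  assumes "r > 1" and "b \<in> binseqs" and "c \<in> binseqs" and "\<And>i. i < n \<Longrightarrow> b i = c i"
    and "b n = 1" and "c n = 0"
  shows "(1 - 1 / (r - 1)) / r ^ Suc n \<le> proj r b - proj r c"
proof -
  let ?b = "\<lambda>i. b (i + Suc n)" and ?c = "\<lambda>i. c (i + Suc n)"
  have "0 \<le> proj r ?b" "proj r ?c \<le> 1 / (r - 1)"
    using assms(1-3) by (intro proj_nonneg proj_le binseqs_shift; simp)+
  then have "1 - 1 / (r - 1) \<le> 1 + proj r ?b - proj r ?c"
    by linarith
  then have "(1 - 1 / (r - 1)) / r ^ Suc n \<le> (1 + proj r ?b - proj r ?c) / r ^ Suc n"
    using assms(1) by (intro divide_right_mono) simp_all
  also have "\<dots> = proj r b - proj r c"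
    using assms by (rule proj_diff_first [symmetric])
  finally show ?thesis .
qed

lemma binseqs_first_diff:
  assumes "b \<in> binseqs" and "c \<in> binseqs" and "b \<noteq> c"
  obtains n where "\<forall>i<n. b i = c i" and "b n = 1 \<and> c n = 0 \<or> b n = 0 \<and> c n = 1"
proof -
  define n where "n = (LEAST n. b n \<noteq> c n)"
  have "\<exists>n. b n \<noteq> c n" using assms(3) by auto
  then have "b n \<noteq> c n" unfolding n_def by (rule LeastI_ex)
  moreover have "b i = c i" if "i < n" for i
    using not_less_Least that unfolding n_def by blast
  ultimately show thesis
    using that[of n] binseqs_cases[OF assms(1), of n] binseqs_cases[OF assms(2), of n] by auto
qed

section \<open>Order on \<open>J p\<close> as lexicographic order of digits\<close>

lemma base_change_proj:
  "p > 2 \<Longrightarrow> b \<in> binseqs \<Longrightarrow> base_change p q (proj p b) = proj q b"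
  by (simp add: base_change_def expansion_proj)

text \<open>For \<open>p > 2\<close> the numerical order on \<open>J p\<close> is the lexicographic
  one: if \<open>c\<close> had the larger digit at the first difference,
  \<open>proj_diff_first_lower\<close> would give \<open>y \<le> x\<close>.\<close>

lemma base_change_less_cases:
  assumes "p > 2" and "x \<in> J p" and "y \<in> J p" and "x < y"
  obtains b c n where "b \<in> binseqs" "c \<in> binseqs" "x = proj p c" "y = proj p b"
    "\<forall>i<n. b i = c i" "b n = 1" "c n = 0"
proof -
  obtain b c where bc: "b \<in> binseqs" "c \<in> binseqs" "x = proj p c" "y = proj p b"
    using assms(2,3) by (auto simp: J_def)
  have "b \<noteq> c" using bc(3,4) assms(4) by auto
  with bc(1,2) obtain n where n: "\<forall>i<n. b i = c i"
      "b n = 1 \<and> c n = 0 \<or> b n = 0 \<and> c n = 1"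
    by (rule binseqs_first_diff)
  have "\<not> (b n = 0 \<and> c n = 1)"
  proof
    assume *: "b n = 0 \<and> c n = 1"
    have "(1 - 1 / (p - 1)) / p ^ Suc n \<le> x - y"
      unfolding bc using * bc n(1) assms(1) by (intro proj_diff_first_lower) auto
    moreover have "0 \<le> (1 - 1 / (p - 1)) / p ^ Suc n" using assms(1) by simp
    ultimately show False using assms(4) by linarith
  qed
  then show thesis using that[of b c n] bc n by auto
qed

section \<open>Hoelder continuity and exactness of the exponent\<close>

lemma power_powr_swap:
  fixes a x :: real
  assumes "a > 0"
  shows "(a ^ n) powr x = (a powr x) ^ n"
  using assms by (induction n) (simp_all add: powr_mult)

lemma holder_base_change:
  assumes "p > 2" and "q > 1"
  shows "holder_on (ln q / ln p) (J p) (base_change p q)"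
proof -
  define \<alpha> where "\<alpha> = ln q / ln p"
  have \<alpha>: "\<alpha> > 0" using assms by (simp add: \<alpha>_def)
  \<comment> \<open>This identity fixes the exponent: it turns the scale \<open>1 / p ^ n\<close> of
    the arguments into the scale \<open>1 / q ^ n\<close> of the values.\<close>
  have p\<alpha>: "p powr \<alpha> = q" using assms by (simp add: \<alpha>_def powr_def)
  define K where "K = 1 - 1 / (p - 1)"
  have K: "K > 0" using assms by (simp add: K_def)
  \<comment> \<open>The division by \<open>K powr \<alpha>\<close> cancels the constant of the lower
    bound in base \<open>p\<close>. The extra factor \<open>q\<close> is needed because that bound
    has exponent \<open>Suc n\<close>, whereas the upper bound in base \<open>q\<close> has exponent
    \<open>n\<close>.\<close>
  define C where "C = q / (q - 1) / K powr \<alpha>"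
  have lt: "\<bar>base_change p q x - base_change p q y\<bar> \<le> C * \<bar>x - y\<bar> powr \<alpha>"
    if xy: "x \<in> J p" "y \<in> J p" "x < y" for x y
  proof -
    obtain b c n where bc: "b \<in> binseqs" "c \<in> binseqs" "x = proj p c" "y = proj p b"
      and n: "\<forall>i<n. b i = c i" "b n = 1" "c n = 0"
      using assms(1) xy by (rule base_change_less_cases)
    have "K / p ^ Suc n \<le> \<bar>x - y\<bar>"
      using proj_diff_first_lower[of p b c n] assms(1) bc n xy(3) by (simp add: K_def)
    then have "(K / p ^ Suc n) powr \<alpha> \<le> \<bar>x - y\<bar> powr \<alpha>"
      using \<alpha> K assms by (intro powr_mono2) auto
    moreover have "(K / p ^ Suc n) powr \<alpha> = K powr \<alpha> / q ^ Suc n"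
    proof -
      have "(p ^ Suc n) powr \<alpha> = q ^ Suc n"
        using assms p\<alpha> power_powr_swap[of p "Suc n" \<alpha>] by simp
      then show ?thesis using K assms by (simp add: powr_divide del: power_Suc)
    qed
    ultimately have "C * (K powr \<alpha> / q ^ Suc n) \<le> C * \<bar>x - y\<bar> powr \<alpha>"
      using assms by (intro mult_left_mono) (auto simp: C_def)
    moreover have "C * (K powr \<alpha> / q ^ Suc n) = 1 / (q - 1) / q ^ n"
      using K assms by (simp add: C_def)
    moreover have "\<bar>proj q b - proj q c\<bar> \<le> 1 / (q - 1) / q ^ n"
      using proj_agree_close[OF assms(2) bc(1,2)] n(1) by simp
    ultimately show ?thesis
      using bc assms(1) by (simp add: base_change_proj abs_minus_commute)
  qed
  have "\<bar>base_change p q x - base_change p q y\<bar> \<le> C * \<bar>x - y\<bar> powr \<alpha>"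
    if "x \<in> J p" "y \<in> J p" for x y
    using lt[of x y] lt[of y x] that by (cases x y rule: linorder_cases) (auto simp: abs_minus_commute)
  then show ?thesis
    using \<alpha> unfolding holder_on_def \<alpha>_def by blast
qed

text \<open>Supplies the test points for exactness: the sequence whose only 1 stands at index
  \<open>n\<close> has the value \<open>1 / r ^ Suc n\<close> in every base
  \<open>r > 1\<close>.\<close>

lemma base_change_power:
  assumes "p > 2" and "q > 1"
  shows "1 / p ^ Suc n \<in> J p" and "base_change p q (1 / p ^ Suc n) = 1 / q ^ Suc n"
proof -
  define e where "e i = (if i = n then 1 else 0 :: nat)" for i
  have e: "e \<in> binseqs" by (auto simp: e_def binseqs_def)
  have z: "(\<lambda>_. 0) \<in> binseqs" by (auto simp: binseqs_def)
  have proj_e: "proj r e = 1 / r ^ Suc n" if "r > 1" for r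
  proof -
    have "proj r e - proj r (\<lambda>_. 0) =
      (1 + proj r (\<lambda>i. e (i + Suc n)) - proj r (\<lambda>_. 0)) / r ^ Suc n"
      by (rule proj_diff_first[OF that e z]) (simp_all add: e_def)
    then show ?thesis by (simp add: e_def proj_zero)
  qed
  have "p > 1" using assms(1) by simp
  show "1 / p ^ Suc n \<in> J p"
    unfolding J_def by (rule image_eqI[OF _ e]) (rule proj_e[OF \<open>p > 1\<close>, symmetric])
  show "base_change p q (1 / p ^ Suc n) = 1 / q ^ Suc n"
    using base_change_proj[OF assms(1) e, of q] unfolding proj_e[OF \<open>p > 1\<close>] proj_e[OF assms(2)] .
qed

lemma base_change_zero:
  assumes "p > 2"
  shows "0 \<in> J p" and "base_change p q 0 = 0"
proof -
  have z: "(\<lambda>_. 0) \<in> binseqs" by (auto simp: binseqs_def)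
  show "0 \<in> J p" unfolding J_def by (rule image_eqI[OF _ z]) (simp add: proj_zero)
  show "base_change p q 0 = 0"
    using base_change_proj[OF assms z, of q] by (simp add: proj_zero)
qed

text \<open>Between \<open>0\<close> and \<open>1 / p ^ Suc n\<close> the Hoelder bound becomes
  \<open>(p powr \<beta> / q) ^ Suc n \<le> C\<close> for all \<open>n\<close>. The ratio exceeds 1
  because \<open>\<beta> > ln q / ln p\<close>, so no \<open>C\<close> suffices.\<close>

lemma not_holder_base_change:
  assumes "p > 2" and "q > 1" and "\<beta> > ln q / ln p"
  shows "\<not> holder_on \<beta> (J p) (base_change p q)"
proof
  assume "holder_on \<beta> (J p) (base_change p q)"
  then obtain C where C: "\<And>x y. x \<in> J p \<Longrightarrow> y \<in> J p \<Longrightarrow>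
      \<bar>base_change p q x - base_change p q y\<bar> \<le> C * \<bar>x - y\<bar> powr \<beta>"
    unfolding holder_on_def by blast
  have "ln q < \<beta> * ln p" using assms by (simp add: divide_less_eq)
  then have "exp (ln q) < exp (\<beta> * ln p)" by (simp only: exp_less_mono)
  then have "q < p powr \<beta>" using assms by (simp add: powr_def)
  then have "1 < p powr \<beta> / q" using assms by simp
  then obtain n where n: "C < (p powr \<beta> / q) ^ n" using real_arch_pow by blast
  \<comment> \<open>The Archimedean step yields exponent \<open>n\<close>, the test points need
    \<open>Suc n\<close>.\<close>
  also have "\<dots> \<le> (p powr \<beta> / q) ^ Suc n"
    using \<open>1 < p powr \<beta> / q\<close> by (intro power_increasing) auto
  finally have less: "C < (p powr \<beta> / q) ^ Suc n" .
  have "1 / q ^ Suc n \<le> C * (1 / p ^ Suc n) powr \<beta>"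
    using C[OF base_change_power(1)[OF assms(1,2), of n] base_change_zero(1)[OF assms(1)]] assms
    unfolding base_change_power(2)[OF assms(1,2)] base_change_zero(2)[OF assms(1)]
    by (simp add: abs_divide abs_mult)
  also have "(1 / p ^ Suc n) powr \<beta> = 1 / (p powr \<beta>) ^ Suc n"
    using assms power_powr_swap[of p "Suc n" \<beta>] by (simp add: powr_divide del: power_Suc)
  finally have "(p powr \<beta>) ^ Suc n / q ^ Suc n \<le> C"
    using assms by (simp add: field_simps del: power_Suc)
  with less show False by (simp add: power_divide del: power_Suc)
qed

section \<open>Monotonicity for \<open>q < 2\<close>, \<open>q > 2\<close> and
  \<open>q = 2\<close>\<close>

lemma nowhere_monotone_base_change:
  assumes "p > 2" and "q > 1" and "q < 2"
  shows "nowhere_monotone_on (J p) (base_change p q)"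
  unfolding nowhere_monotone_on_def
proof (intro allI impI, elim conjE)
  fix I :: "real set"
  assume "open I" and "I \<inter> J p \<noteq> {}"
  then obtain b where b: "b \<in> binseqs" "proj p b \<in> I" by (auto simp: J_def)
  obtain e where e: "e > 0" "\<And>x. \<bar>x - proj p b\<bar> < e \<Longrightarrow> x \<in> I"
    using \<open>open I\<close> b(2) unfolding open_dist by (auto simp: dist_real_def)
  have "1 / p < 1" using assms by simp
  then obtain n where n: "(1 / p) ^ n < e" using real_arch_pow_inv[OF e(1)] by blast
  \<comment> \<open>The whole cylinder of the first \<open>n\<close> digits of \<open>b\<close> maps
    into \<open>I\<close>, since \<open>p - 1 > 1\<close> makes its diameter at most
    \<open>(1 / p) ^ n\<close>.\<close>
  have near: "proj p c \<in> I" if "c \<in> binseqs" "\<And>i. i < n \<Longrightarrow> c i = b i" for c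
  proof (rule e(2))
    have "\<bar>proj p c - proj p b\<bar> \<le> 1 / (p - 1) / p ^ n"
      using assms that b by (intro proj_agree_close) auto
    also have "\<dots> \<le> (1 / p) ^ n"
      using assms by (simp add: power_divide field_simps)
    finally show "\<bar>proj p c - proj p b\<bar> < e" using n by linarith
  qed
  \<comment> \<open>With \<open>w\<close> the first \<open>n\<close> digits of \<open>b\<close>,
    these are \<open>u = w1000...\<close>, \<open>v = w0111...\<close> and
    \<open>z = w0000...\<close>. In base \<open>p\<close>, \<open>u\<close> is the largest of the
    three; in base \<open>q\<close> it lies below \<open>v\<close> but above \<open>z\<close>. The
    pair \<open>v, u\<close> thus excludes \<open>mono_on\<close> and the pair \<open>z, u\<close>
    excludes \<open>antimono_on\<close>.\<close>
  define u where "u i = (if i < n then b i else if i = n then 1 else 0)" for i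
  define v where "v i = (if i < n then b i else if i = n then 0 else 1)" for i
  define z where "z i = (if i < n then b i else 0)" for i
  have bin: "u \<in> binseqs" "v \<in> binseqs" "z \<in> binseqs"
    using b(1) by (auto simp: u_def v_def z_def binseqs_def Pi_def)
  have in_IJ: "proj p u \<in> I \<inter> J p" "proj p v \<in> I \<inter> J p" "proj p z \<in> I \<inter> J p"
    using near bin by (auto simp: J_def u_def v_def z_def)
  have uv: "proj r u - proj r v = (1 - 1 / (r - 1)) / r ^ Suc n" if "r > 1" for r
  proof -
    have "proj r u - proj r v =
      (1 + proj r (\<lambda>i. u (i + Suc n)) - proj r (\<lambda>i. v (i + Suc n))) / r ^ Suc n"
      by (rule proj_diff_first[OF that bin(1,2)]) (simp_all add: u_def v_def)
    moreover have "(\<lambda>i. u (i + Suc n)) = (\<lambda>_. 0)" "(\<lambda>i. v (i + Suc n)) = (\<lambda>_. 1)"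
      by (simp_all add: u_def v_def)
    ultimately show ?thesis by (simp only: proj_zero proj_one[OF that] add_0_right)
  qed
  have uz: "proj r u - proj r z = 1 / r ^ Suc n" if "r > 1" for r
  proof -
    have "proj r u - proj r z =
      (1 + proj r (\<lambda>i. u (i + Suc n)) - proj r (\<lambda>i. z (i + Suc n))) / r ^ Suc n"
      by (rule proj_diff_first[OF that bin(1,3)]) (simp_all add: u_def z_def)
    then show ?thesis by (simp add: u_def z_def proj_zero)
  qed
  have "0 < (1 - 1 / (p - 1)) / p ^ Suc n" "0 < 1 / p ^ Suc n" "0 < 1 / q ^ Suc n"
    using assms by auto
  moreover have "(1 - 1 / (q - 1)) / q ^ Suc n < 0"
    using assms by (intro divide_neg_pos) auto
  ultimately have "proj p v < proj p u" "proj p z < proj p u"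
      "proj q u < proj q v" "proj q z < proj q u"
    using uv[of p] uv[of q] uz[of p] uz[of q] assms by linarith+
  then show "\<not> (mono_on (I \<inter> J p) (base_change p q) \<or> antimono_on (I \<inter> J p) (base_change p q))"
    using in_IJ bin base_change_proj[OF assms(1), of _ q]
    unfolding monotone_on_def by (metis less_imp_le not_le)
qed

lemma strict_mono_base_change:
  assumes "p > 2" and "q > 2"
  shows "strict_mono_on (J p) (base_change p q)"
proof (rule strict_mono_onI)
  fix x y assume "x \<in> J p" "y \<in> J p" "x < y"
  with assms(1) obtain b c n where bc: "b \<in> binseqs" "c \<in> binseqs" "x = proj p c" "y = proj p b"
    and n: "\<forall>i<n. b i = c i" "b n = 1" "c n = 0"
    by (rule base_change_less_cases)
  have "(1 - 1 / (q - 1)) / q ^ Suc n \<le> proj q b - proj q c"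
    using bc n assms by (intro proj_diff_first_lower) auto
  moreover have "0 < (1 - 1 / (q - 1)) / q ^ Suc n" using assms by simp
  ultimately have "proj q c < proj q b" by linarith
  then show "base_change p q x < base_change p q y"
    using bc assms by (simp add: base_change_proj)
qed

lemma mono_base_change_two:
  assumes "p > 2"
  shows "mono_on (J p) (base_change p 2)"
proof (rule mono_onI)
  fix x y assume xy: "x \<in> J p" "y \<in> J p" "x \<le> y"
  show "base_change p 2 x \<le> base_change p 2 y"
  proof (cases "x = y")
    case False
    with xy have "x < y" by simp
    with assms xy(1,2) obtain b c n where bc: "b \<in> binseqs" "c \<in> binseqs" "x = proj p c" "y = proj p b"
      and n: "\<forall>i<n. b i = c i" "b n = 1" "c n = 0"
      by (rule base_change_less_cases)
    \<comment> \<open>The lower bound is exactly 0 here, so only the weak inequality survives: in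
      base 2, \<open>w1000...\<close> and \<open>w0111...\<close> have the same value.\<close>
    have "(1 - 1 / (2 - 1)) / 2 ^ Suc n \<le> proj 2 b - proj 2 c"
      using bc n by (intro proj_diff_first_lower) auto
    then show ?thesis using bc assms by (simp add: base_change_proj)
  qed simp
qed

theorem theorem1p5:
  fixes p q :: real
  assumes "p > 2" and "q > 1"
  shows "exact_holder_on (ln q / ln p) (J p) (base_change p q) \<and>
         (q < 2 \<longrightarrow> nowhere_monotone_on (J p) (base_change p q)) \<and>
         (q = 2 \<longrightarrow> mono_on (J p) (base_change p q)) \<and>
         (q > 2 \<longrightarrow> strict_mono_on (J p) (base_change p q))"
  using assms holder_base_change not_holder_base_change nowhere_monotone_base_change
    mono_base_change_two strict_mono_base_change
  unfolding exact_holder_on_def by blast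

end
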